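(* Let $k=\mathbb F_q$ be a finite field with $q$ elements, $t\ge 1$ an integer, $a,b\in\mathbb Z$, and let $p\in\mathbb P^1_k$ be a point of degree $1$. Let $A^{R_p(t)}_{a,b}=|Gr_{(a,b)}(R_p(t))|$ be the number of submodules of dimension vector $(a,b)$ of the indecomposable regular Kronecker module $R_p(t)$ over $k$. Then $$A^{R_p(t)}_{a,b}=\begin{cases}0 & \text{if } a<0 \text{ or } b<0,\\ G^{t-a}_{t-b}(q)\,G^{a-b}_{a}(q) & \text{otherwise.}\end{cases}$$
   Context: A Kronecker module over $k$ is a representation $V=(V_1,V_2;\alpha,\beta)$ consisting of finite dimensional $k$-vector spaces $V_1,V_2$ and two linear maps $\alpha,\beta:V_2\to V_1$; its dimension vector is $(\dim V_1,\dim V_2)$. A submodule is a pair of subspaces $U_i\subseteq V_i$ with $\alpha(U_2)+\beta(U_2)\subseteq U_1$; its dimension vector is $(\dim U_1,\dim U_2)$. For a point $p\in\mathbb P^1_k$ of degree $1$ (a $k$-rational point, i.e. an element of $k\cup\{\infty\}$) and $t\ge1$, $R_p(t)$ is the indecomposable regular module of dimension vector $(t,t)$ and regular length $t$ in the tube of $p$: $V_1=V_2=k^t$, with $\alpha=\mathrm{id}$, $\beta=J_t(\lambda)$ (the $t\times t$ Jordan block with eigenvalue $\lambda$) if $p=\lambda\in k$, and $\alpha=J_t(0)$, $\beta=\mathrm{id}$ if $p=\infty$. Gaussian coefficients: for $a,l\in\mathbb Z$ with $l>0$, $G^l_a(q)=\frac{(q^a-1)(q^{a-1}-1)\cdots(q^{a-l+1}-1)}{(q^l-1)\cdots(q-1)}$;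 $G^0_a(q)=1$; $G^{l}_a(q)=0$ for $l<0$. The lower index $a$ may be negative. *)

theory Defs
  imports
    "HOL-Library.Cardinality"
    "HOL-Algebra.AbelCoset"
    "Jordan_Normal_Form.VS_Connect"
    "Jordan_Normal_Form.Jordan_Normal_Form"
begin

record ('a, 'v, 'w) kronecker =
  sp1 :: "('a, 'v) module"
  sp2 :: "('a, 'w) module"
  mapA :: "'w \<Rightarrow> 'v"
  mapB :: "'w \<Rightarrow> 'v"

locale kronecker_module =
  fixes K :: "('a, 'm) ring_scheme" and M :: "('a, 'v, 'w) kronecker"
  assumes linA: "linear_map K (sp2 M) (sp1 M) (mapA M)"
    and linB: "linear_map K (sp2 M) (sp1 M) (mapB M)"
    and fin1: "vectorspace.fin_dim K (sp1 M)"
    and fin2: "vectorspace.fin_dim K (sp2 M)"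

definition is_kr_submodule ::
  "('a, 'm) ring_scheme \<Rightarrow> ('a, 'v, 'w) kronecker \<Rightarrow> 'v set \<times> 'w set \<Rightarrow> bool" where
  "is_kr_submodule K M = (\<lambda>(U1, U2).
     VectorSpace.subspace K U1 (sp1 M) \<and> VectorSpace.subspace K U2 (sp2 M) \<and>
     mapA M ` U2 <+>\<^bsub>sp1 M\<^esub> mapB M ` U2 \<subseteq> U1)"

definition subspace_dim :: "('a, 'm) ring_scheme \<Rightarrow> ('a, 'v) module \<Rightarrow> 'v set \<Rightarrow> nat" where
  "subspace_dim K V U = vectorspace.dim K (V\<lparr>carrier := U\<rparr>)"

definition kr_Gr ::
  "('a, 'm) ring_scheme \<Rightarrow> ('a, 'v, 'w) kronecker \<Rightarrow> int \<Rightarrow> int \<Rightarrow> ('v set \<times> 'w set) set" where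
  "kr_Gr K M a b = {(U1, U2). is_kr_submodule K M (U1, U2) \<and>
     int (subspace_dim K (sp1 M) U1) = a \<and> int (subspace_dim K (sp2 M) U2) = b}"

text \<open>The points of degree 1 of the projective line over \<open>k\<close>, i.e. \<open>k \<union> {\<infinity>}\<close>.\<close>

datatype 'k point = Fin_point 'k | Inf_point

definition regular_module :: "'k::field point \<Rightarrow> nat \<Rightarrow> ('k, 'k vec, 'k vec) kronecker" where
  "regular_module p t =
     \<lparr>sp1 = module_vec TYPE('k) t, sp2 = module_vec TYPE('k) t,
      mapA = (\<lambda>v. (case p of Fin_point c \<Rightarrow> 1\<^sub>m t | Inf_point \<Rightarrow> jordan_block t 0) *\<^sub>v v),
      mapB = (\<lambda>v. (case p of Fin_point c \<Rightarrow> jordan_block t c | Inf_point \<Rightarrow> 1\<^sub>m t) *\<^sub>v v)\<rparr>"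

text \<open>\<open>gauss q l a\<close> is $G^l_a(q)$: the upper index comes first. As the lower index may be
  negative, the exponents in the numerator are integers.\<close>

definition gauss :: "'a::field \<Rightarrow> int \<Rightarrow> int \<Rightarrow> 'a" where
  "gauss q l a =
     (if l < 0 then 0
      else if l = 0 then 1
      else (\<Prod>i = 0..<l. q powi (a - i) - 1) / (\<Prod>j = 1..l. q powi j - 1))"

lemma linear_map_mult_mat_vec:
  fixes A :: "'k::field mat"
  assumes A: "A \<in> carrier_mat n m"
  shows "linear_map class_ring (module_vec TYPE('k) m) (module_vec TYPE('k) n) (\<lambda>v. A *\<^sub>v v)"
proof -
  interpret V: vec_space "TYPE('k)" m .
  interpret W: vec_space "TYPE('k)" n .
  have "(\<lambda>v. A *\<^sub>v v) \<in> LinearCombinations.module_hom class_ring (module_vec TYPE('k) m) (module_vec TYPE('k) n)"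
    unfolding LinearCombinations.module_hom_def module_vec_simps
    using A by (simp add: mult_add_distrib_mat_vec[OF A] mult_mat_vec[OF A])
  then show ?thesis
    by (intro linear_map.intro mod_hom.intro V.vectorspace_axioms W.vectorspace_axioms
        V.module_axioms W.module_axioms mod_hom_axioms.intro)
qed

lemma kronecker_module_regular_module:
  fixes p :: "'k::field point"
  shows "kronecker_module class_ring (regular_module p t)"
proof -
  interpret V: vec_space "TYPE('k)" t .
  have J: "jordan_block t c \<in> carrier_mat t t" for c :: 'k
    by (simp add: jordan_block_def)
  have L: "linear_map class_ring (module_vec TYPE('k) t) (module_vec TYPE('k) t) (\<lambda>v. A *\<^sub>v v)"
    if "A \<in> carrier_mat t t" for A :: "'k mat"
    using that by (rule linear_map_mult_mat_vec)
  show ?thesis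
    by (intro kronecker_module.intro; cases p;
        simp add: regular_module_def V.fin_dim L[OF J] L[OF one_carrier_mat])
qed

end

(* In the monomial basis a Jordan block acts on the polynomials of degree < t as a combination of the
   identity and the shift D f = (f - f(0)) / x. So at every point p the submodules are the pairs of
   subspaces U2 <= U1 with D U2 <= U1. As D has kernel spanned by 1 and maps onto the polynomials of
   degree < t - 1, one can count by induction on t: let A(t;a,b) be the number of pairs of dimensions
   (a,b), and B(t;a,b) the number of those with 1 not in U2. If 1 lies in U2, the pair (D U1, D U2)
   determines (U1, U2); if not, each such image pair has a number of lifts that is a power of q. Thus
     A(t+1;a+1,b+1) = A(t;a,b) + B(t+1;a+1,b+1),
     B(t+1;a+1,b) = q^b A(t;a,b) + q^(a+1-b) B(t;a+1,b),
   and the closed forms follow from the Pascal rule for Gaussian coefficients. *)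
theory Submission
  imports Defs
begin

subsection \<open>Lifts along the shift\<close>

interpretation poly_vs: vector_space "Polynomial.smult :: 'k::field \<Rightarrow> 'k poly \<Rightarrow> 'k poly"
  by unfold_locales (simp_all add: smult_add_right smult_add_left)

abbreviation "D \<equiv> (poly_shift (Suc 0) :: 'k::field poly \<Rightarrow> 'k poly)"

lemma D_pCons [simp]: "poly_shift (Suc 0) (pCons c f) = f"
  by (simp add: poly_eq_iff coeff_poly_shift)

lemma pCons_D: "pCons (coeff f 0) (poly_shift (Suc 0) f) = f"
  by (rule poly_eqI) (simp add: coeff_pCons coeff_poly_shift split: nat.split)

lemma D_add: "D (f + g) = D f + D g"
  and D_smult: "D (Polynomial.smult c f) = Polynomial.smult c (D f)"
  by (simp_all add: poly_eq_iff coeff_poly_shift)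

interpretation D: Vector_Spaces.linear Polynomial.smult Polynomial.smult "D :: 'k::field poly \<Rightarrow> 'k poly"
  by unfold_locales (simp_all only: D_add D_smult)

lemma D_eq_0_iff: "D f = 0 \<longleftrightarrow> (\<exists>c. f = [:c:])"
  by (metis D_pCons One_nat_def pCons_D)

text \<open>The kernel of \<open>D\<close> is the line of constants, so a subspace either contains
  it or meets it only in 0, and membership of \<open>1\<close> tells which. In the first case the
  subspace is a full preimage under \<open>D\<close>; in the second \<open>D\<close> is injective on
  it.\<close>

lemma one_in_subspace:
  assumes "poly_vs.subspace U" "[:c:] \<in> U" "c \<noteq> 0"
  shows "1 \<in> U"
  using poly_vs.subspace_scale[OF assms(1,2), of "inverse c"] assms(3) by (simp add: one_pCons)

lemma inj_on_D:
  assumes "poly_vs.subspace U" "1 \<notin> U"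
  shows "inj_on D U"
proof (rule inj_onI)
  fix f g assume fg: "f \<in> U" "g \<in> U" "D f = D g"
  then have "D (f - g) = 0" by (simp only: D.diff) simp
  then obtain c where c: "f - g = [:c:]" unfolding D_eq_0_iff by auto
  have "[:c:] \<in> U" using poly_vs.subspace_diff[OF assms(1) fg(1,2)] c by simp
  then show "f = g" using one_in_subspace[OF assms(1)] assms(2) c by force
qed

lemma vimage_D_image_D:
  assumes "poly_vs.subspace U" "1 \<in> U"
  shows "D -` (D ` U) = U"
proof
  show "D -` (D ` U) \<subseteq> U"
  proof
    fix f assume "f \<in> D -` (D ` U)"
    then obtain u where u: "u \<in> U" "D f = D u" by auto
    then have "D (f - u) = 0" by (simp only: D.diff) simp
    then obtain c where c: "f - u = [:c:]" unfolding D_eq_0_iff by auto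
    have "Polynomial.smult c 1 + u \<in> U" using assms u by (intro poly_vs.subspace_add poly_vs.subspace_scale)
    moreover have "Polynomial.smult c 1 + u = f" using c by (simp add: one_pCons algebra_simps)
    ultimately show "f \<in> U" by simp
  qed
qed auto

lemma vimage_D_eq: "D -` W = (\<lambda>(c, f). pCons c f) ` (UNIV \<times> W)"
  by (auto simp: image_iff) (metis pCons_D)

lemma image_D_vimage_D: "D ` (D -` W) = W"
  by (metis D_pCons image_vimage_eq inf_top.right_neutral surjI)

lemma surj_D [simp]: "range (D :: 'k::field poly \<Rightarrow> _) = UNIV"
  by (metis D_pCons surjI)

lemma card_vimage_D: "card (D -` W) = CARD('k::{field,finite}) * card (W :: 'k poly set)"
  unfolding vimage_D_eq by (subst card_image) (auto simp: inj_on_def card_cartesian_product)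

lemma finite_vimage_D: "finite (W :: 'k::{field,finite} poly set) \<Longrightarrow> finite (D -` W)"
  unfolding vimage_D_eq by simp

text \<open>A lift U of Y avoiding \<open>1\<close> is the image of a linear section of
  \<open>D\<close> over Y, and containing S prescribes the section on the image of S. The remaining
  freedom is Hom(Y / D S, k), of size \<open>card Y\<close> / \<open>card S\<close>. The proof
  enlarges S one dimension at a time, and the product form avoids division.\<close>

lemma card_lifts:
  fixes Y S :: "'k::{field,finite} poly set"
  assumes Y: "poly_vs.subspace Y" "finite Y"
    and S: "poly_vs.subspace S" "1 \<notin> S" "D ` S \<subseteq> Y"
  shows "card {U. poly_vs.subspace U \<and> S \<subseteq> U \<and> 1 \<notin> U \<and> D ` U = Y} * card S = card Y"
  using S
proof (induction "card Y - card S" arbitrary: S rule: less_induct)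
  case less
  let ?N = "\<lambda>S. {U. poly_vs.subspace U \<and> S \<subseteq> U \<and> 1 \<notin> U \<and> D ` U = Y}"
  note S = less.prems
  have cS: "card (D ` S) = card S" by (rule card_image[OF inj_on_D[OF S(1,2)]])
  have finS: "finite S" using S Y(2) by (meson finite_imageD finite_subset inj_on_D)
  show ?case
  proof (cases "D ` S = Y")
    case True
    have "?N S = {S}"
    proof (intro equalityI subsetI)
      fix U assume "U \<in> ?N S"
      then have U: "poly_vs.subspace U" "S \<subseteq> U" "1 \<notin> U" "D ` U = Y" by auto
      have "U = S" using inj_on_image_eq_iff[OF inj_on_D[OF U(1,3)], of U S] U True by auto
      then show "U \<in> {S}" by simp
    qed (use S True in auto)
    then show ?thesis using True cS by simp
  next
    case False
    \<comment> \<open>Every lift contains exactly one preimage of \<open>y\<close>; split the lifts according to it.\<close>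
    then obtain y where y: "y \<in> Y" "y \<notin> D ` S" using S by blast
    \<comment> \<open>\<open>pCons c y\<close> is the preimage of y with constant term c, and
      \<open>T c\<close> adjoins it to S. As an image of a product \<open>T c\<close> can be
      counted; as a span it is the least subspace that a lift of this class has to contain.\<close>
    define T where "T c = (\<lambda>(s, d). s + Polynomial.smult d (pCons c y)) ` (S \<times> UNIV)" for c
    have T: "T c = poly_vs.span (insert (pCons c y) S)" for c
    proof -
      have "poly_vs.span S = S" using S(1) by (simp add: poly_vs.span_eq_iff)
      then have "poly_vs.span (insert (pCons c y) S) = {x. \<exists>d. x - Polynomial.smult d (pCons c y) \<in> S}"
        unfolding poly_vs.span_insert by (simp only:)
      also have "\<dots> = T c"
      proof (intro equalityI subsetI)
        fix x assume "x \<in> {x. \<exists>d. x - Polynomial.smult d (pCons c y) \<in> S}"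
        then obtain d where "x - Polynomial.smult d (pCons c y) \<in> S" by blast
        then show "x \<in> T c" unfolding T_def
          by (intro image_eqI[of _ _ "(x - Polynomial.smult d (pCons c y), d)"]) auto
      next
        fix x assume "x \<in> T c"
        then obtain s d where "s \<in> S" "x = s + Polynomial.smult d (pCons c y)"
          unfolding T_def by auto
        then have "x - Polynomial.smult d (pCons c y) \<in> S" by simp
        then show "x \<in> {x. \<exists>d. x - Polynomial.smult d (pCons c y) \<in> S}" by blast
      qed
      finally show ?thesis by simp
    qed
    have sT: "poly_vs.subspace (T c)" for c unfolding T by simp
    \<comment> \<open>Since y is outside the image of S, that image and the line of y are
      independent. This keeps \<open>1\<close> out of \<open>T c\<close> and makes the
      parametrisation of \<open>T c\<close> injective.\<close>
    have indep: "d = 0" if "s \<in> S" "s' \<in> S" "D s + Polynomial.smult d y = D s'" for s s' d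
    proof (rule ccontr)
      assume "d \<noteq> 0"
      have "Polynomial.smult d y = D (s' - s)" using that(3) by (simp add: D.diff algebra_simps)
      then have "y = D (Polynomial.smult (inverse d) (s' - s))" using \<open>d \<noteq> 0\<close>
        by (metis D_smult left_inverse poly_vs.scale_one poly_vs.scale_scale)
      moreover have "Polynomial.smult (inverse d) (s' - s) \<in> S"
        using S that by (intro poly_vs.subspace_scale poly_vs.subspace_diff)
      ultimately show False using y by blast
    qed
    have D_T: "D (s + Polynomial.smult d (pCons c y)) = D s + Polynomial.smult d y" for s d c
      by (simp only: D_add D_smult) simp
    have oneT: "1 \<notin> T c" for c
    proof
      assume "1 \<in> T c"
      then obtain s d where s: "s \<in> S" "1 = s + Polynomial.smult d (pCons c y)" unfolding T_def by auto
      have "D s + Polynomial.smult d y = D 0" using D_T[of s d c] s(2) by (simp add: poly_shift_1)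
      then have "d = 0" using indep[of s 0 d] s S(1) poly_vs.subspace_0 by blast
      then show False using s S(2) by simp
    qed
    have DT: "D ` T c \<subseteq> Y" for c
      unfolding T_def using S(3) y(1) Y(1)
      by (auto simp only: D_T intro!: poly_vs.subspace_add poly_vs.subspace_scale)
    have cardT: "card (T c) = card S * CARD('k)" for c
    proof -
      have "inj_on (\<lambda>(s, d). s + Polynomial.smult d (pCons c y)) (S \<times> UNIV)"
      proof (rule inj_onI, clarify)
        fix s d s' d' assume s: "s \<in> S" "s' \<in> S"
          and eq: "s + Polynomial.smult d (pCons c y) = s' + Polynomial.smult d' (pCons c y)"
        then have "D s + Polynomial.smult d y = D s' + Polynomial.smult d' y"
          using D_T by metis
        then have "D s + Polynomial.smult (d - d') y = D s'"
          by (simp add: smult_diff_left algebra_simps)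
        then have "d - d' = 0" using indep s by blast
        then show "s = s' \<and> d = d'" using eq by simp
      qed
      then show ?thesis unfolding T_def by (simp add: card_image card_cartesian_product)
    qed
    have card2: "CARD('k) \<ge> 2"
      using card_mono[of "UNIV :: 'k set" "{0,1}"] by simp
    have "card S > 0" using S(1) finS poly_vs.subspace_0 by (auto simp: card_gt_0_iff)
    then have "card S < card (T c)" for c using cardT card2 by simp
    \<comment> \<open>The measure \<open>card Y - card S\<close> is a truncated difference, so it
      drops only because it is still positive at S.\<close>
    moreover have "card S < card Y"
      using psubset_card_mono[OF Y(2), of "D ` S"] False S(3) cS by auto
    ultimately have IH: "card (?N (T c)) * card (T c) = card Y" for c
      by (intro less.hyps sT oneT DT) (simp add: diff_less_mono2)
    have N: "?N S = (\<Union>c. ?N (T c))"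
    proof (intro equalityI subsetI)
      fix U assume "U \<in> ?N S"
      then have U: "poly_vs.subspace U" "S \<subseteq> U" "1 \<notin> U" "D ` U = Y" by auto
      then obtain u where u: "u \<in> U" "D u = y" using y by auto
      then have "pCons (coeff u 0) y \<in> U" using pCons_D[of u] by simp
      then have "T (coeff u 0) \<subseteq> U" using U unfolding T by (intro poly_vs.span_minimal) auto
      then show "U \<in> (\<Union>c. ?N (T c))" using U by auto
    next
      fix U assume "U \<in> (\<Union>c. ?N (T c))"
      moreover have "S \<subseteq> T c" for c unfolding T using poly_vs.span_superset by blast
      ultimately show "U \<in> ?N S" by blast
    qed
    have fin: "finite (?N (T c))" for c
      by (rule finite_subset[of _ "Pow (D -` Y)"]) (auto simp: finite_vimage_D[OF Y(2), simplified])
    have disj: "?N (T c) \<inter> ?N (T c') = {}" if "c \<noteq> c'" for c c'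
    proof (rule ccontr)
      assume "?N (T c) \<inter> ?N (T c') \<noteq> {}"
      then obtain U where U: "poly_vs.subspace U" "T c \<subseteq> U" "T c' \<subseteq> U" "1 \<notin> U" by auto
      have "pCons c y \<in> U" "pCons c' y \<in> U" using U(2,3) unfolding T
        by (meson insertI1 poly_vs.span_base subsetD)+
      then have "pCons c y = pCons c' y" using inj_onD[OF inj_on_D[OF U(1,4)], of "pCons c y" "pCons c' y"] by simp
      then show False using that by simp
    qed
    \<comment> \<open>Each of the q classes contributes \<open>card Y\<close>, because
      \<open>card (T c)\<close> is q times \<open>card S\<close>; the common factor q then
      cancels.\<close>
    have "card (?N S) * card S * CARD('k) = (\<Sum>c\<in>UNIV. card (?N (T c))) * (card S * CARD('k))"
      unfolding N by (subst card_UN_disjoint) (use fin disj in auto)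
    also have "\<dots> = (\<Sum>c\<in>(UNIV::'k set). card Y)"
      unfolding sum_distrib_right using IH cardT by simp
    finally show ?thesis by simp
  qed
qed

subsection \<open>Recursions for the number of pairs\<close>

text \<open>Phrased by vanishing coefficients because the zero polynomial has \<open>degree\<close>
  0: a strict degree bound would give the empty set for t = 0.\<close>

definition polys :: "nat \<Rightarrow> 'k::field poly set" where
  "polys t = {f. \<forall>i\<ge>t. coeff f i = 0}"

lemma polys_0: "polys 0 = {0}"
  by (auto simp: polys_def poly_eq_iff)

lemma polys_Suc: "polys (Suc t) = D -` (polys t :: 'k::field poly set)"
proof -
  have "(\<forall>i\<ge>Suc t. coeff f i = 0) \<longleftrightarrow> (\<forall>i\<ge>t. coeff f (Suc i) = 0)" for f :: "'k poly"
    by (metis Suc_le_D Suc_le_mono)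
  then show ?thesis by (auto simp: polys_def coeff_poly_shift)
qed

lemma finite_polys: "finite (polys t :: 'k::{field,finite} poly set)"
proof (induction t)
  case (Suc t)
  then show ?case unfolding polys_Suc by (rule finite_vimage_D)
qed (simp add: polys_0)

text \<open>Over a finite field a subspace has dimension d exactly when it has q^d elements, so
  dimensions are recorded as cardinalities and the counting needs no bases.\<close>

definition pairs :: "nat \<Rightarrow> nat \<Rightarrow> nat \<Rightarrow> ('k::{field,finite} poly set \<times> 'k poly set) set" where
  "pairs t a b = {(U1, U2). poly_vs.subspace U1 \<and> poly_vs.subspace U2 \<and> U1 \<subseteq> polys t \<and>
     U2 \<subseteq> U1 \<and> D ` U2 \<subseteq> U1 \<and> card U1 = CARD('k) ^ a \<and> card U2 = CARD('k) ^ b}"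

definition pairs0 :: "nat \<Rightarrow> nat \<Rightarrow> nat \<Rightarrow> ('k::{field,finite} poly set \<times> 'k poly set) set" where
  "pairs0 t a b = {(U1, U2) \<in> pairs t a b. 1 \<notin> U2}"

lemma finite_pairs: "finite (pairs t a b)"
proof (rule finite_subset)
  show "pairs t a b \<subseteq> Pow (polys t) \<times> Pow (polys t)" unfolding pairs_def by auto
qed (simp add: finite_polys)

lemma finite_pairs0: "finite (pairs0 t a b)"
  by (rule finite_subset[OF _ finite_pairs]) (auto simp: pairs0_def)

lemma card_field_ge_2: "CARD('k::{field,finite}) \<ge> 2"
  using card_mono[of "UNIV :: 'k set" "{0,1}"] by simp

lemma card_subspace_eq_1_iff:
  "poly_vs.subspace U \<Longrightarrow> card U = 1 \<longleftrightarrow> U = {0}"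
  using poly_vs.subspace_0[of U] by (auto simp: card_1_singleton_iff)

section \<open>Degenerate cases: dimension zero\<close>

lemma pairs_0_left:
  "pairs t 0 b = (if b = 0 then {({0}, {0 :: 'k::{field,finite} poly})} else {})"
proof -
  have *: "b = 0 \<and> U1 = {0} \<and> U2 = {0}" if "(U1, U2) \<in> pairs t 0 b" for U1 U2 :: "'k poly set"
  proof -
    have U: "poly_vs.subspace U1" "poly_vs.subspace U2" "U2 \<subseteq> U1" "card U1 = 1" "card U2 = CARD('k) ^ b"
      using that unfolding pairs_def by auto
    then have "U1 = {0}" using card_subspace_eq_1_iff by blast
    then have "U2 = {0}" using U poly_vs.subspace_0 by blast
    moreover from this have "CARD('k) ^ b = 1" using U by simp
    then have "b = 0" using card_field_ge_2[where 'k='k] by simp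
    ultimately show ?thesis using \<open>U1 = {0}\<close> by simp
  qed
  have "pairs t 0 b \<subseteq> (if b = 0 then {({0}, {0 :: 'k poly})} else {})"
  proof (rule subrelI)
    fix U1 U2 :: "'k poly set" assume "(U1, U2) \<in> pairs t 0 b"
    from *[OF this] show "(U1, U2) \<in> (if b = 0 then {({0}, {0})} else {})" by simp
  qed
  moreover have "({0}, {0 :: 'k poly}) \<in> pairs t 0 0"
    by (simp add: pairs_def polys_def)
  then have "(if b = 0 then {({0}, {0 :: 'k poly})} else {}) \<subseteq> pairs t 0 b" by simp
  ultimately show ?thesis by (rule equalityI)
qed

text \<open>The recursion for \<open>pairs\<close> starts at positive b; here b = 0 is passed on to
  \<open>pairs0\<close>, since a zero space U2 cannot contain \<open>1\<close>.\<close>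

lemma pairs_0_right: "pairs t a 0 = pairs0 t a 0"
proof -
  have "1 \<notin> U2" if "(U1, U2) \<in> pairs t a 0" for U1 U2 :: "'a poly set"
  proof -
    have "poly_vs.subspace U2" "card U2 = 1" using that by (auto simp: pairs_def)
    then have "U2 = {0}" by (simp only: card_subspace_eq_1_iff)
    then show ?thesis by simp
  qed
  then show ?thesis by (auto simp: pairs0_def)
qed

lemma pairs0_0_left: "pairs0 t 0 b = (if b = 0 then {({0}, {0})} else {})"
  by (auto simp: pairs0_def pairs_0_left)

lemma pairs_dim_0:
  assumes "a > 0"
  shows "pairs 0 a b = ({} :: ('k::{field,finite} poly set \<times> _) set)"
proof -
  have False if "(U1, U2) \<in> pairs 0 a b" for U1 U2 :: "'k poly set"
  proof -
    have "poly_vs.subspace U1" "U1 \<subseteq> {0}" "card U1 = CARD('k) ^ a"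
      using that unfolding pairs_def polys_0 by auto
    then have "CARD('k) ^ a = 1" using card_subspace_eq_1_iff poly_vs.subspace_0
      by (metis all_not_in_conv subset_singletonD)
    then show False using assms card_field_ge_2[where 'k='k] by simp
  qed
  then show ?thesis by auto
qed

lemma pairs0_dim_0: "a > 0 \<Longrightarrow> pairs0 0 a b = {}"
  by (simp add: pairs0_def pairs_dim_0)

section \<open>The two recursions\<close>

lemma card_image_D_1_notin:
  "poly_vs.subspace U \<Longrightarrow> 1 \<notin> U \<Longrightarrow> card (D ` U) = card U"
  by (simp add: card_image inj_on_D)

lemma card_image_D_1_in:
  fixes U :: "'k::{field,finite} poly set"
  shows "poly_vs.subspace U \<Longrightarrow> 1 \<in> U \<Longrightarrow> card U = CARD('k) * card (D ` U)"
  using card_vimage_D[of "D ` U"] by (simp only: vimage_D_image_D)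

lemma one_in_vimage_D: "poly_vs.subspace W \<Longrightarrow> 1 \<in> D -` W"
  by (simp add: poly_shift_1 poly_vs.subspace_0)

text \<open>If \<open>1\<close> lies in U2, it lies in U1 too, so both spaces are full preimages of
  W1 and W2. The inclusion of D U2 = W2 in the preimage of W1 says precisely that D W2 lies in W1,
  so the image pair satisfies the same conditions one size lower.\<close>

lemma card_pairs_Suc:
  "card (pairs (Suc t) (Suc a) (Suc b) :: ('k::{field,finite} poly set \<times> _) set) =
   card (pairs t a b :: ('k poly set \<times> _) set) +
   card (pairs0 (Suc t) (Suc a) (Suc b) :: ('k poly set \<times> _) set)"
proof -
  let ?P = "pairs (Suc t) (Suc a) (Suc b) :: ('k poly set \<times> _) set"
  let ?P1 = "{(U1, U2) \<in> ?P. 1 \<in> U2}"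
  let ?f = "\<lambda>(W1, W2). (D -` W1, D -` W2) :: 'k poly set \<times> 'k poly set"
  have "bij_betw ?f (pairs t a b) ?P1"
  proof (rule bij_betw_byWitness[where f' = "\<lambda>(U1, U2). (D ` U1, D ` U2)"])
    show "\<forall>w\<in>pairs t a b. (case ?f w of (U1, U2) \<Rightarrow> (D ` U1, D ` U2)) = w"
      by (auto simp only: image_D_vimage_D split: prod.splits)
    show "\<forall>u\<in>?P1. ?f (case u of (U1, U2) \<Rightarrow> (D ` U1, D ` U2)) = u"
      unfolding pairs_def by clarify (metis subsetD vimage_D_image_D)
    show "?f ` pairs t a b \<subseteq> ?P1"
      unfolding pairs_def
      by (auto simp: polys_Suc card_vimage_D D.subspace_vimage image_D_vimage_D one_in_vimage_D
          simp del: vimage_eq)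
    show "(\<lambda>(U1, U2). (D ` U1, D ` U2)) ` ?P1 \<subseteq> pairs t a b"
      unfolding pairs_def polys_Suc
      using card_field_ge_2[where 'k='k]
      by (auto simp: D.subspace_image card_image_D_1_in)
  qed
  then have "card (pairs t a b :: ('k poly set \<times> _) set) = card ?P1" by (rule bij_betw_same_card)
  moreover have P: "?P = ?P1 \<union> pairs0 (Suc t) (Suc a) (Suc b)"
      "?P1 \<inter> pairs0 (Suc t) (Suc a) (Suc b) = {}"
    by (auto simp: pairs0_def)
  moreover have "finite ?P1" by (rule finite_subset[OF _ finite_pairs]) blast
  moreover have "card ?P = card (?P1 \<union> pairs0 (Suc t) (Suc a) (Suc b))"
    using P(1) by (rule arg_cong[where f = card])
  ultimately show ?thesis using card_Un_disjoint[OF _ finite_pairs0 P(2)] by presburger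
qed

text \<open>Counting along fibres; the factor m allows fibres of size n / m without dividing
  naturals.\<close>

lemma card_times_eq_of_fibers:
  assumes "finite X" "finite P" "f ` X \<subseteq> P" "\<And>w. w \<in> P \<Longrightarrow> card {x \<in> X. f x = w} * m = n"
  shows "card X * m = n * card P"
proof -
  have "card X = (\<Sum>w\<in>P. card {x \<in> X. f x = w})"
    using sum.group[OF assms(1-3), of "\<lambda>_. 1 :: nat"] by simp
  then show ?thesis using assms(4) by (simp add: sum_distrib_right)
qed

text \<open>The pairs are split by whether \<open>1\<close> lies in U1, and the fibres of the image
  map under \<open>D\<close> are counted by \<open>card_lifts\<close>. Multiplying by q^b clears the
  exponent a + 1 - b, which may be negative.\<close>

lemma card_pairs0_Suc:
  "card (pairs0 (Suc t) (Suc a) b :: ('k::{field,finite} poly set \<times> _) set) * CARD('k) ^ b =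
   CARD('k) ^ (2 * b) * card (pairs t a b :: ('k poly set \<times> _) set) +
   CARD('k) ^ Suc a * card (pairs0 t (Suc a) b :: ('k poly set \<times> _) set)"
proof -
  let ?P = "pairs0 (Suc t) (Suc a) b :: ('k poly set \<times> _) set"
  let ?P1 = "{(U1, U2) \<in> ?P. 1 \<in> U1}" and ?P2 = "{(U1, U2) \<in> ?P. 1 \<notin> U1}"
  let ?f = "\<lambda>(U1, U2). (D ` U1, D ` U2) :: 'k poly set \<times> 'k poly set"
  have fin: "finite ?P1" "finite ?P2"
    by (rule finite_subset[OF _ finite_pairs0], blast)+
  have finU: "finite U" if "U \<subseteq> polys s" for s and U :: "'k poly set"
    using finite_subset[OF that finite_polys] .
  have q: "CARD('k) > 0" by simp
  \<comment> \<open>Here U1 is the full preimage of W1, and U2 may be any lift of W2 avoiding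
    \<open>1\<close>: both required inclusions then follow from W2 and D W2 lying in W1.
    \<open>card_lifts\<close> with S = {0} gives q^b choices.\<close>
  have 1: "card ?P1 * 1 = CARD('k) ^ b * card (pairs t a b :: ('k poly set \<times> _) set)"
  proof (rule card_times_eq_of_fibers[OF fin(1) finite_pairs, where f = ?f])
    show "?f ` ?P1 \<subseteq> pairs t a b"
      unfolding pairs_def pairs0_def polys_Suc
      using q by (auto simp: D.subspace_image card_image_D_1_in card_image_D_1_notin)
    fix w :: "'k poly set \<times> 'k poly set" assume "w \<in> pairs t a b"
    then obtain W1 W2 where w: "w = (W1, W2)" and W: "poly_vs.subspace W1" "poly_vs.subspace W2"
      "W1 \<subseteq> polys t" "W2 \<subseteq> W1" "D ` W2 \<subseteq> W1" "card W1 = CARD('k) ^ a" "card W2 = CARD('k) ^ b"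
      unfolding pairs_def by auto
    let ?L = "{U. poly_vs.subspace U \<and> {0} \<subseteq> U \<and> 1 \<notin> U \<and> D ` U = W2}"
    have "{x \<in> ?P1. ?f x = w} = (\<lambda>U. (D -` W1, U)) ` ?L"
    proof (intro equalityI subsetI)
      fix x assume "x \<in> {x \<in> ?P1. ?f x = w}"
      then obtain U1 U2 where x: "x = (U1, U2)" "D ` U1 = W1" "D ` U2 = W2"
        "poly_vs.subspace U1" "poly_vs.subspace U2" "1 \<in> U1" "1 \<notin> U2"
        unfolding w pairs_def pairs0_def by auto
      then have "U1 = D -` W1" using vimage_D_image_D by blast
      then show "x \<in> (\<lambda>U. (D -` W1, U)) ` ?L" using x poly_vs.subspace_0 by blast
    next
      fix x assume "x \<in> (\<lambda>U. (D -` W1, U)) ` ?L"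
      then obtain U where x: "x = (D -` W1, U)" and U: "poly_vs.subspace U" "1 \<notin> U" "D ` U = W2"
        by auto
      have "U \<subseteq> D -` W1" using U(3) W(4) by blast
      moreover have "D ` U \<subseteq> D -` W1" using U(3) W(5) by blast
      moreover have "D -` W1 \<subseteq> D -` polys t" using W(3) by blast
      moreover have "card U = CARD('k) ^ b"
        using card_image_D_1_notin[OF U(1,2)] U(3) W(7) by simp
      ultimately show "x \<in> {x \<in> ?P1. ?f x = w}"
        using U W unfolding x w pairs_def pairs0_def polys_Suc
        by (simp add: D.subspace_vimage card_vimage_D image_D_vimage_D one_in_vimage_D
            del: vimage_eq)
    qed
    then have "card {x \<in> ?P1. ?f x = w} = card ((\<lambda>U. (D -` W1, U)) ` ?L)"
      by (rule arg_cong[where f = card])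
    also have "\<dots> = card ?L * 1"
      by (subst card_image) (simp_all add: inj_on_def)
    also have "card ?L * 1 = CARD('k) ^ b"
    proof -
      have "finite W2" using finite_subset[OF W(4)] finU[OF W(3)] by blast
      moreover have "D ` {0} \<subseteq> W2" using poly_vs.subspace_0[OF W(2)] by simp
      ultimately have "card ?L * card {0 :: 'k poly} = card W2"
        by (intro card_lifts W(2) poly_vs.subspace_single_0) simp_all
      then show "card ?L * 1 = CARD('k) ^ b" using W(7) by simp
    qed
    finally show "card {x \<in> ?P1. ?f x = w} * 1 = CARD('k) ^ b" by simp
  qed
  \<comment> \<open>Here \<open>D\<close> is injective on U1, so U2 is forced to be the part of U1
    lying over W2. What remains is a lift U1 of W1 that contains W2 = D U2, and
    \<open>card_lifts\<close> with S = W2 counts these. As W2 lies in U1, it avoids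
    \<open>1\<close>.\<close>
  have 2: "card ?P2 * CARD('k) ^ b = CARD('k) ^ Suc a * card (pairs0 t (Suc a) b :: ('k poly set \<times> _) set)"
  proof (rule card_times_eq_of_fibers[OF fin(2) finite_pairs0, where f = ?f])
    show "?f ` ?P2 \<subseteq> pairs0 t (Suc a) b"
    proof (rule image_subsetI)
      fix x assume "x \<in> ?P2"
      then obtain U1 U2 where x: "x = (U1, U2)" and U: "poly_vs.subspace U1" "poly_vs.subspace U2"
        "U1 \<subseteq> polys (Suc t)" "U2 \<subseteq> U1" "D ` U2 \<subseteq> U1" "card U1 = CARD('k) ^ Suc a"
        "card U2 = CARD('k) ^ b" "1 \<notin> U1" "1 \<notin> U2"
        unfolding pairs_def pairs0_def by auto
      have "D ` D ` U2 \<subseteq> D ` U1" "D ` U2 \<subseteq> D ` U1" "D ` U1 \<subseteq> polys t" "1 \<notin> D ` U2"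
        using U unfolding polys_Suc by auto
      then show "?f x \<in> pairs0 t (Suc a) b"
        using U unfolding x pairs_def pairs0_def
        by (simp add: D.subspace_image card_image_D_1_notin)
    qed
    fix w :: "'k poly set \<times> 'k poly set" assume "w \<in> pairs0 t (Suc a) b"
    then obtain W1 W2 where w: "w = (W1, W2)" and W: "poly_vs.subspace W1" "poly_vs.subspace W2"
      "W1 \<subseteq> polys t" "W2 \<subseteq> W1" "D ` W2 \<subseteq> W1" "card W1 = CARD('k) ^ Suc a"
      "card W2 = CARD('k) ^ b" "1 \<notin> W2"
      unfolding pairs_def pairs0_def by auto
    let ?L = "{U. poly_vs.subspace U \<and> W2 \<subseteq> U \<and> 1 \<notin> U \<and> D ` U = W1}"
    have "{x \<in> ?P2. ?f x = w} = (\<lambda>U. (U, U \<inter> D -` W2)) ` ?L"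
    proof (intro equalityI subsetI)
      fix x assume "x \<in> {x \<in> ?P2. ?f x = w}"
      then obtain U1 U2 where x: "x = (U1, U2)" "D ` U1 = W1" "D ` U2 = W2"
        "poly_vs.subspace U1" "1 \<notin> U1" "U2 \<subseteq> U1" "D ` U2 \<subseteq> U1"
        unfolding w pairs_def pairs0_def by auto
      have "U2 = U1 \<inter> D -` W2"
        using inj_on_D[OF x(4,5)] x(3,6) by (auto dest: inj_onD)
      moreover have "U1 \<in> ?L" using x by simp
      ultimately show "x \<in> (\<lambda>U. (U, U \<inter> D -` W2)) ` ?L" unfolding x(1) by (intro image_eqI[of _ _ U1]) simp_all
    next
      fix x assume "x \<in> (\<lambda>U. (U, U \<inter> D -` W2)) ` ?L"
      then obtain U where x: "x = (U, U \<inter> D -` W2)"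
        and U: "poly_vs.subspace U" "W2 \<subseteq> U" "1 \<notin> U" "D ` U = W1"
        by auto
      have sub: "poly_vs.subspace (U \<inter> D -` W2)"
        using U(1) W(2) by (intro poly_vs.subspace_inter D.subspace_vimage)
      \<comment> \<open>All of W2 is reached because it lies in W1, the image of U.\<close>
      have im: "D ` (U \<inter> D -` W2) = W2" using U(4) W(4) by blast
      have "card (U \<inter> D -` W2) = CARD('k) ^ b"
        using card_image_D_1_notin[OF sub] U(3) unfolding im W(7) by simp
      moreover have "card U = CARD('k) ^ Suc a" using card_image_D_1_notin[OF U(1,3)] U(4) W(6) by simp
      moreover have "U \<subseteq> D -` polys t" using U(4) W(3) by blast
      ultimately show "x \<in> {x \<in> ?P2. ?f x = w}"
        using U sub im unfolding x w pairs_def pairs0_def polys_Suc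
        by (simp add: Int_lower1 del: vimage_eq image_vimage_eq)
    qed
    then have "card {x \<in> ?P2. ?f x = w} = card ((\<lambda>U. (U, U \<inter> D -` W2)) ` ?L)"
      by (rule arg_cong[where f = card])
    also have "\<dots> = card ?L"
      by (rule card_image) (simp add: inj_on_def)
    finally show "card {x \<in> ?P2. ?f x = w} * CARD('k) ^ b = CARD('k) ^ Suc a"
      using card_lifts[of W1 W2] W finU[of W1] by simp
  qed
  have P: "?P = ?P1 \<union> ?P2" "?P1 \<inter> ?P2 = {}" by auto
  have card: "card ?P = card ?P1 + card ?P2"
    unfolding card_Un_disjoint[OF fin P(2), symmetric] using P(1) by (rule arg_cong[where f = card])
  show ?thesis
    unfolding card add_mult_distrib 2 1[unfolded mult_1_right] mult_2 power_add by (simp only: ac_simps)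
qed

subsection \<open>Gaussian coefficients\<close>

text \<open>For l = 0 both products are empty, so only the sign of l has to be
  distinguished.\<close>

lemma gauss_nonneg:
  "0 \<le> l \<Longrightarrow> gauss q l a = (\<Prod>i = 0..<l. q powi (a - i) - 1) / (\<Prod>j = 1..l. q powi j - 1)"
  by (simp add: gauss_def)

lemma gauss_neg: "l < 0 \<Longrightarrow> gauss q l a = 0"
  by (simp add: gauss_def)

lemma gauss_self:
  fixes q :: "'a::linordered_field"
  assumes "1 < q" "0 \<le> l"
  shows "gauss q l l = 1"
proof -
  have "(\<Prod>i = 0..<l. q powi (l - i) - 1) = (\<Prod>j = 1..l. q powi j - 1)"
    by (rule prod.reindex_bij_witness[of _ "\<lambda>j. l - j" "\<lambda>i. l - i"]) auto
  moreover have "q powi j \<noteq> 1" if "j \<in> {1..l}" for j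
    using that assms(1) power_int_strict_increasing[of 0 j q] by auto
  then have "(\<Prod>j = 1..l. q powi j - 1) \<noteq> 0" by simp
  ultimately show ?thesis by (simp only: gauss_nonneg[OF assms(2)] divide_self_if if_False)
qed

text \<open>Splitting off the first numerator factor for a + 1 and the last one for a leaves the
  same product N. The claim becomes q^(a+1) - 1 = (q^(a+1-l) - 1) + q^(a+1-l) (q^l - 1). It holds
  for negative a too, so later uses need no case split on the sign of the lower index.\<close>

lemma gauss_pascal:
  fixes q :: "'a::linordered_field"
  assumes q: "1 < q"
  shows "gauss q l (a + 1) = gauss q l a + q powi (a + 1 - l) * gauss q (l - 1) a"
proof (cases "l \<le> 0")
  case True
  then show ?thesis by (simp add: gauss_def)
next
  case False
  define N where "N = (\<Prod>i = 0..<l - 1. q powi (a - i) - 1)"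
  define M where "M = (\<Prod>j = 1..l - 1. q powi j - 1)"
  have "(\<Prod>i = 0..<l. q powi (a + 1 - i) - 1) =
      (\<Prod>i \<in> insert 0 {1..<l}. q powi (a + 1 - i) - 1)"
    by (rule prod.cong) (use False in auto)
  also have "\<dots> = (q powi (a + 1) - 1) * (\<Prod>i = 1..<l. q powi (a + 1 - i) - 1)"
    by (subst prod.insert) auto
  also have "(\<Prod>i = 1..<l. q powi (a + 1 - i) - 1) = N" unfolding N_def
    by (rule prod.reindex_bij_witness[of _ "\<lambda>j. j + 1" "\<lambda>i. i - 1"]) (auto simp: algebra_simps)
  finally have 1: "(\<Prod>i = 0..<l. q powi (a + 1 - i) - 1) = (q powi (a + 1) - 1) * N" .
  have "{0..<l} = insert (l - 1) {0..<l - 1}" using False by auto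
  then have 2: "(\<Prod>i = 0..<l. q powi (a - i) - 1) = (q powi (a + 1 - l) - 1) * N"
    unfolding N_def by (simp add: algebra_simps)
  have "{1..l} = insert l {1..l - 1}" using False by auto
  then have 3: "(\<Prod>j = 1..l. q powi j - 1) = (q powi l - 1) * M"
    unfolding M_def by simp
  have ne: "q powi j \<noteq> 1" if "1 \<le> j" for j
    using that q power_int_strict_increasing[of 0 j q] by auto
  then have "M \<noteq> 0" "q powi l - 1 \<noteq> 0" using False unfolding M_def by auto
  moreover have "q powi (a + 1) = q powi (a + 1 - l) * q powi l"
    using q by (simp add: power_int_add[symmetric])
  ultimately show ?thesis
    using False by (simp add: gauss_nonneg 1 2 3 N_def[symmetric] M_def[symmetric])
      (simp add: field_simps)
qed

text \<open>Both counts are treated in one induction on t, as each recursion involves the other. In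
  the second formula a = 0 is separate: the product would vanish, its last upper index being -1 - b,
  although the zero pair exists for b = 0.\<close>

lemma card_pairs_closed:
  fixes q :: rat and t a b :: nat
  assumes "q = of_nat CARD('k::{field,finite})"
  shows "of_nat (card (pairs t a b :: ('k poly set \<times> _) set)) =
      gauss q (int t - int a) (int t - int b) * gauss q (int a - int b) (int a)"
    and "of_nat (card (pairs0 t a b :: ('k poly set \<times> _) set)) =
      (if a = 0 then if b = 0 then 1 else 0
       else q ^ b * gauss q (int t - int a) (int t - int b) * gauss q (int a - 1 - int b) (int a - 1))"
proof (induction t arbitrary: a b)
  case 0
  {
    case 1
    show ?case by (cases "a = 0") (simp_all add: pairs_0_left pairs_dim_0 gauss_def)
  next
    case 2
    show ?case by (cases "a = 0") (simp_all add: pairs0_0_left pairs0_dim_0 gauss_def)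
  }
next
  case (Suc t)
  have q: "1 < q" using card_field_ge_2[where 'k='k] assms by linarith
  \<comment> \<open>The recursion for \<open>pairs\<close> at \<open>Suc t\<close> refers to
    \<open>pairs0\<close> at the same size, so the second claim comes first.\<close>
  have B: "of_nat (card (pairs0 (Suc t) a b :: ('k poly set \<times> _) set)) =
      (if a = 0 then if b = 0 then 1 else 0
       else q ^ b * gauss q (int (Suc t) - int a) (int (Suc t) - int b) *
         gauss q (int a - 1 - int b) (int a - 1))" for a b
  proof (cases a)
    case 0
    then show ?thesis by (simp add: pairs0_0_left)
  next
    case (Suc c)
    let ?G = "gauss q (int c - int b) (int c)"
    have "of_nat (card (pairs0 (Suc t) (Suc c) b :: ('k poly set \<times> _) set)) * q ^ b =
        q ^ (2 * b) * (gauss q (int t - int c) (int t - int b) * ?G) +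
        q ^ Suc c * (q ^ b * gauss q (int t - int c - 1) (int t - int b) * ?G)"
      using arg_cong[OF card_pairs0_Suc[of t c b, where 'k='k], of "of_nat :: _ \<Rightarrow> rat"]
        Suc.IH(1)[of c b] Suc.IH(2)[of "Suc c" b] assms
      by (simp add: algebra_simps)
    also have "\<dots> = q ^ b * (q ^ b * (gauss q (int t - int c) (int t - int b) +
        q powi (int c + 1 - int b) * gauss q (int t - int c - 1) (int t - int b)) * ?G)"
    proof -
      have "q powi (int c + 1 - int b) * q ^ b = q ^ Suc c"
        using q by (simp add: power_int_diff power_int_add)
      from this[symmetric] show ?thesis by (simp only: mult_2 mult_2_right power_add ring_distribs ac_simps)
    qed
    \<comment> \<open>Pascal's rule with upper index t - c and lower index t - b, since (t - b) + 1
      - (t - c) = c + 1 - b.\<close>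
    also have "gauss q (int t - int c) (int t - int b) +
        q powi (int c + 1 - int b) * gauss q (int t - int c - 1) (int t - int b) =
        gauss q (int t - int c) (int t - int b + 1)"
      using gauss_pascal[OF q, of "int t - int c" "int t - int b"] by (simp add: algebra_simps)
    finally show ?thesis using q Suc by (simp add: algebra_simps)
  qed
  {
    case 2
    show ?case by (rule B)
  next
    case 1
    \<comment> \<open>\<open>card_pairs_Suc\<close> covers positive a and b only; the two boundary
      cases are read off directly.\<close>
    consider "a = 0" | "a > 0" "b = 0" | c d where "a = Suc c" "b = Suc d"
      by (metis neq0_conv not0_implies_Suc)
    then show ?case
    proof cases
      case 1
      then show ?thesis using q by (auto simp: pairs_0_left gauss_self gauss_neg)
    next
      case 2
      then show ?thesis using B[of a 0] q by (simp add: pairs_0_right gauss_self)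
    next
      case 3
      \<comment> \<open>The two summands of \<open>card_pairs_Suc\<close> share the factor
        \<open>gauss q (int t - int c) (int t - int d)\<close>; their cofactors add up by this
        instance of Pascal's rule.\<close>
      have "gauss q (int c - int d) (int c + 1) =
          gauss q (int c - int d) (int c) + q ^ Suc d * gauss q (int c - int d - 1) (int c)"
        using gauss_pascal[OF q, of "int c - int d" "int c"] q
        by (simp add: power_int_add algebra_simps)
      then show ?thesis
        using card_pairs_Suc[of t c d, where 'k='k] Suc.IH(1)[of c d] B[of "Suc c" "Suc d"]
        unfolding 3 by (simp add: algebra_simps)
    qed
  }
qed

subsection \<open>Kronecker submodules as pairs of spaces of polynomials\<close>

text \<open>Coordinates with respect to a basis identify the space with the functions from the basis
  to the field; taking them extensional makes the coordinates unique.\<close>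

lemma (in vectorspace) card_carrier_eq_power_dim:
  assumes "finite (carrier K)" "finite (carrier V)"
  shows "card (carrier V) = card (carrier K) ^ dim"
proof -
  have "span (carrier V) = carrier V"
    using in_own_span[of "carrier V"] span_is_subset2[of "carrier V"] by auto
  then have "fin_dim" unfolding fin_dim_def using assms(2) by blast
  then obtain B where B: "finite B" "basis B" using finite_basis_exists by blast
  then have BV: "B \<subseteq> carrier V" by (simp add: basis_def)
  have ex1: "\<forall>v. v \<in> carrier V \<longrightarrow> (\<exists>!a. a \<in> B \<rightarrow>\<^sub>E carrier K \<and> lincomb a B = v)"
    using basis_criterion[OF B(1) BV] B(2) by simp
  have closed: "lincomb a B \<in> carrier V" if "a \<in> B \<rightarrow>\<^sub>E carrier K" for a
    using that BV by (intro lincomb_closed) auto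
  have "bij_betw (\<lambda>a. lincomb a B) (B \<rightarrow>\<^sub>E carrier K) (carrier V)"
  proof (rule bij_betw_imageI)
    show "inj_on (\<lambda>a. lincomb a B) (B \<rightarrow>\<^sub>E carrier K)"
      using ex1 closed by (intro inj_onI) metis
    show "(\<lambda>a. lincomb a B) ` (B \<rightarrow>\<^sub>E carrier K) = carrier V"
      using ex1 closed by blast
  qed
  then have "card (carrier V) = card (B \<rightarrow>\<^sub>E carrier K)" by (simp add: bij_betw_same_card)
  also have "\<dots> = card (carrier K) ^ card B" using B(1) by (simp add: card_PiE)
  finally show ?thesis using dim_basis[OF B] by simp
qed

section \<open>Coordinate vectors as polynomials\<close>

definition poly_of_coeffs :: "'k::field vec \<Rightarrow> 'k poly" where
  "poly_of_coeffs v = Poly (list_of_vec v)"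

lemma coeff_poly_of_coeffs: "coeff (poly_of_coeffs v) i = (if i < dim_vec v then v $ i else 0)"
  by (simp add: poly_of_coeffs_def coeff_Poly_eq nth_default_def length_list_of_vec list_of_vec_index)

lemma poly_of_coeffs_add:
  "v \<in> carrier_vec t \<Longrightarrow> w \<in> carrier_vec t \<Longrightarrow>
    poly_of_coeffs (v + w) = poly_of_coeffs v + poly_of_coeffs w"
  by (rule poly_eqI) (simp add: coeff_poly_of_coeffs)

lemma poly_of_coeffs_smult: "poly_of_coeffs (c \<cdot>\<^sub>v v) = Polynomial.smult c (poly_of_coeffs v)"
  by (rule poly_eqI) (simp add: coeff_poly_of_coeffs)

lemma poly_of_coeffs_zero: "poly_of_coeffs (0\<^sub>v t) = 0"
  by (rule poly_eqI) (simp add: coeff_poly_of_coeffs)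

lemma inj_on_poly_of_coeffs: "inj_on poly_of_coeffs (carrier_vec t)"
proof (rule inj_onI, rule eq_vecI)
  fix v w :: "'a vec" and i
  assume vw: "v \<in> carrier_vec t" "w \<in> carrier_vec t" "poly_of_coeffs v = poly_of_coeffs w"
  then have "coeff (poly_of_coeffs v) i = coeff (poly_of_coeffs w) i" by simp
  then show "v $ i = w $ i" if "i < dim_vec w" using that vw(1,2) by (simp add: coeff_poly_of_coeffs)
qed simp

lemma image_poly_of_coeffs: "poly_of_coeffs ` carrier_vec t = (polys t :: 'k::field poly set)"
proof
  show "poly_of_coeffs ` carrier_vec t \<subseteq> (polys t :: 'k poly set)"
    by (auto simp: polys_def coeff_poly_of_coeffs)
  show "(polys t :: 'k poly set) \<subseteq> poly_of_coeffs ` carrier_vec t"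
  proof
    fix f :: "'k poly" assume "f \<in> polys t"
    then have "f = poly_of_coeffs (vec t (coeff f))"
      by (intro poly_eqI) (simp add: polys_def coeff_poly_of_coeffs)
    then show "f \<in> poly_of_coeffs ` carrier_vec t" by (rule image_eqI) simp
  qed
qed

text \<open>The ones of the block stand above the diagonal, so entry i receives entry i + 1, which
  is the shift of coefficients. The last row has no such one, matching the vanishing coefficient of
  x^t.\<close>

lemma poly_of_coeffs_jordan_block:
  assumes "v \<in> carrier_vec t"
  shows "poly_of_coeffs (jordan_block t c *\<^sub>v v) =
    Polynomial.smult c (poly_of_coeffs v) + D (poly_of_coeffs v)"
proof (rule poly_eqI)
  fix i
  have "(jordan_block t c *\<^sub>v v) $ i = c * v $ i + (if Suc i < t then v $ Suc i else 0)" if i: "i < t"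
  proof -
    have "i < dim_row (jordan_block t c)" using i by simp
    then have "(jordan_block t c *\<^sub>v v) $ i = row (jordan_block t c) i \<bullet> v"
      by (rule index_mult_mat_vec)
    also have "\<dots> =
        (\<Sum>j = 0..<t. (if j = i then c * v $ j else 0) + (if j = Suc i then v $ j else 0))"
      unfolding scalar_prod_def using assms i by (intro sum.cong) (auto simp: jordan_block_def)
    finally show ?thesis using i by (simp add: sum.distrib)
  qed
  then show "coeff (poly_of_coeffs (jordan_block t c *\<^sub>v v)) i =
      coeff (Polynomial.smult c (poly_of_coeffs v) + D (poly_of_coeffs v)) i"
    using assms by (simp add: coeff_poly_of_coeffs coeff_poly_shift)
qed

text \<open>\<open>poly_of_coeffs\<close> is linear and injective on \<open>carrier_vec t\<close>,
  so every closure condition carries over in both directions.\<close>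

lemma subspace_module_vec_iff:
  assumes "U \<subseteq> carrier_vec t"
  shows "VectorSpace.subspace class_ring U (module_vec TYPE('k::field) t) \<longleftrightarrow>
    poly_vs.subspace (poly_of_coeffs ` U)"
proof -
  interpret V: vec_space "TYPE('k)" t .
  have 1: "VectorSpace.subspace class_ring U (module_vec TYPE('k) t) \<longleftrightarrow>
      0\<^sub>v t \<in> U \<and> (\<forall>v\<in>U. \<forall>w\<in>U. v + w \<in> U) \<and> (\<forall>c. \<forall>v\<in>U. c \<cdot>\<^sub>v v \<in> U)"
    unfolding VectorSpace.subspace_def submodule_def
    using assms V.vectorspace_axioms V.module_axioms by (auto simp: class_ring_simps module_vec_simps)
  have mem: "poly_of_coeffs v \<in> poly_of_coeffs ` U \<longleftrightarrow> v \<in> U" if "v \<in> carrier_vec t" for v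
    using inj_on_image_mem_iff[OF inj_on_poly_of_coeffs that assms] .
  have a: "poly_of_coeffs v + poly_of_coeffs w \<in> poly_of_coeffs ` U \<longleftrightarrow> v + w \<in> U"
    if "v \<in> U" "w \<in> U" for v w
    using that assms mem[of "v + w"] by (subst poly_of_coeffs_add[symmetric, of _ t]) auto
  have s: "Polynomial.smult c (poly_of_coeffs v) \<in> poly_of_coeffs ` U \<longleftrightarrow> c \<cdot>\<^sub>v v \<in> U"
    if "v \<in> U" for v c
    using that assms mem[of "c \<cdot>\<^sub>v v"] by (subst poly_of_coeffs_smult[symmetric]) auto
  have z: "0 \<in> poly_of_coeffs ` U \<longleftrightarrow> 0\<^sub>v t \<in> U"
    using mem[of "0\<^sub>v t"] by (simp add: poly_of_coeffs_zero)
  show ?thesis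
    unfolding 1 poly_vs.subspace_def by (simp add: a s z)
qed

lemma finite_carrier_vec: "finite (carrier_vec t :: 'k::{field,finite} vec set)"
  by (rule finite_imageD[OF _ inj_on_poly_of_coeffs]) (simp add: image_poly_of_coeffs finite_polys)

text \<open>Links dimensions to the cardinalities used in \<open>pairs\<close>; as q is at least 2,
  the exponent of q^d is determined.\<close>

lemma subspace_dim_eq_iff:
  assumes "VectorSpace.subspace class_ring U (module_vec TYPE('k::{field,finite}) t)"
  shows "subspace_dim class_ring (module_vec TYPE('k) t) U = d \<longleftrightarrow> card U = CARD('k) ^ d"
proof -
  interpret V: vec_space "TYPE('k)" t .
  interpret W: vectorspace "class_ring :: 'k ring" "(module_vec TYPE('k) t)\<lparr>carrier := U\<rparr>"
    using V.subspace_is_vs[OF assms] .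
  have "U \<subseteq> carrier_vec t"
    using assms by (auto simp: VectorSpace.subspace_def submodule_def module_vec_simps)
  then have "finite U" using finite_carrier_vec finite_subset by blast
  then have "card U = CARD('k) ^ subspace_dim class_ring (module_vec TYPE('k) t) U"
    using W.card_carrier_eq_power_dim by (simp add: subspace_dim_def class_ring_simps)
  then show ?thesis using card_field_ge_2[where 'k='k] by simp
qed

text \<open>On polynomials the two maps are the identity and c + D, or \<open>D\<close> and the
  identity. Either way they have the same linear span as the identity and \<open>D\<close>, so the
  condition no longer depends on the point.\<close>

lemma kr_condition_iff:
  fixes p :: "'k::field point"
  assumes "U1 \<subseteq> carrier_vec t" "U2 \<subseteq> carrier_vec t"
    and "poly_vs.subspace (poly_of_coeffs ` U1)" "poly_vs.subspace (poly_of_coeffs ` U2)"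
  shows "mapA (regular_module p t) ` U2 <+>\<^bsub>sp1 (regular_module p t)\<^esub> mapB (regular_module p t) ` U2 \<subseteq> U1 \<longleftrightarrow>
    poly_of_coeffs ` U2 \<subseteq> poly_of_coeffs ` U1 \<and> D ` poly_of_coeffs ` U2 \<subseteq> poly_of_coeffs ` U1"
    (is "?lhs \<longleftrightarrow> ?rhs")
proof -
  let ?P1 = "poly_of_coeffs ` U1" and ?P2 = "poly_of_coeffs ` U2"
  let ?A = "\<lambda>f. case p of Fin_point c \<Rightarrow> f | Inf_point \<Rightarrow> D f"
  let ?B = "\<lambda>f. case p of Fin_point c \<Rightarrow> Polynomial.smult c f + D f | Inf_point \<Rightarrow> f"
  have J: "jordan_block t c \<in> carrier_mat t t" for c :: 'k
    by (simp add: jordan_block_def)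
  have maps: "mapA (regular_module p t) v \<in> carrier_vec t" "mapB (regular_module p t) v \<in> carrier_vec t"
    "poly_of_coeffs (mapA (regular_module p t) v) = ?A (poly_of_coeffs v)"
    "poly_of_coeffs (mapB (regular_module p t) v) = ?B (poly_of_coeffs v)"
    if "v \<in> carrier_vec t" for v
    using that mult_mat_vec_carrier[OF J]
    by (auto simp: regular_module_def poly_of_coeffs_jordan_block split: point.split)
  have "?lhs \<longleftrightarrow> (\<forall>v\<in>U2. \<forall>w\<in>U2. mapA (regular_module p t) v + mapB (regular_module p t) w \<in> U1)"
    by (auto simp: set_add_def set_mult_def) (auto simp: regular_module_def module_vec_simps)
  also have "\<dots> \<longleftrightarrow> (\<forall>v\<in>U2. \<forall>w\<in>U2. ?A (poly_of_coeffs v) + ?B (poly_of_coeffs w) \<in> ?P1)"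
  proof (intro ball_cong refl)
    fix v w assume "v \<in> U2" "w \<in> U2"
    then have vw: "v \<in> carrier_vec t" "w \<in> carrier_vec t" using assms by auto
    let ?u = "mapA (regular_module p t) v + mapB (regular_module p t) w"
    have "?u \<in> carrier_vec t" using maps vw by simp
    then have "poly_of_coeffs ?u \<in> ?P1 \<longleftrightarrow> ?u \<in> U1"
      using assms(1) by (rule inj_on_image_mem_iff[OF inj_on_poly_of_coeffs])
    moreover have "poly_of_coeffs ?u = ?A (poly_of_coeffs v) + ?B (poly_of_coeffs w)"
      using maps[OF vw(1)] maps[OF vw(2)] poly_of_coeffs_add by metis
    ultimately show "?u \<in> U1 \<longleftrightarrow> ?A (poly_of_coeffs v) + ?B (poly_of_coeffs w) \<in> ?P1" by simp
  qed
  also have "\<dots> \<longleftrightarrow> (\<forall>f\<in>?P2. \<forall>g\<in>?P2. ?A f + ?B g \<in> ?P1)" by simp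
  also have "\<dots> \<longleftrightarrow> ?rhs"
  proof
    assume L: "\<forall>f\<in>?P2. \<forall>g\<in>?P2. ?A f + ?B g \<in> ?P1"
    have "f \<in> ?P1 \<and> D f \<in> ?P1" if f: "f \<in> ?P2" for f
    proof (cases p)
      case (Fin_point c)
      \<comment> \<open>Inserting 0 for one argument separates the set sum into a condition on each
        map.\<close>
      have "?A f + ?B 0 \<in> ?P1" "?A 0 + ?B f \<in> ?P1" using L f poly_vs.subspace_0[OF assms(4)] by blast+
      then have 1: "f \<in> ?P1" and 2: "Polynomial.smult c f + D f \<in> ?P1" by (simp_all add: Fin_point)
      have "Polynomial.smult c f + D f - Polynomial.smult c f \<in> ?P1"
        using assms(3) 2 poly_vs.subspace_scale[OF assms(3) 1] by (rule poly_vs.subspace_diff)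
      then show ?thesis using 1 by simp
    next
      case Inf_point
      have "?A f + ?B 0 \<in> ?P1" "?A 0 + ?B f \<in> ?P1" using L f poly_vs.subspace_0[OF assms(4)] by blast+
      then show ?thesis by (simp add: Inf_point)
    qed
    then show ?rhs by blast
  next
    assume R: ?rhs
    show "\<forall>f\<in>?P2. \<forall>g\<in>?P2. ?A f + ?B g \<in> ?P1"
    proof (intro ballI)
      fix f g assume "f \<in> ?P2" "g \<in> ?P2"
      then have "f \<in> ?P1" "D f \<in> ?P1" "g \<in> ?P1" "D g \<in> ?P1" using R by blast+
      then show "?A f + ?B g \<in> ?P1"
        using poly_vs.subspace_add[OF assms(3)] poly_vs.subspace_scale[OF assms(3)]
        by (cases p) simp_all
    qed
  qed
  finally show ?thesis .
qed

section \<open>The quiver Grassmannian in bijection with \<open>pairs\<close>\<close>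

lemma mem_kr_Gr_iff:
  fixes p :: "'k::{field,finite} point"
  assumes U: "U1 \<subseteq> carrier_vec t" "U2 \<subseteq> carrier_vec t"
  shows "(U1, U2) \<in> kr_Gr class_ring (regular_module p t) (int a) (int b) \<longleftrightarrow>
    (poly_of_coeffs ` U1, poly_of_coeffs ` U2) \<in> pairs t a b"
proof -
  have card: "card (poly_of_coeffs ` W) = card W" if "W \<subseteq> carrier_vec t" for W :: "'k vec set"
    using inj_on_subset[OF inj_on_poly_of_coeffs that] by (rule card_image)
  have sub: "poly_of_coeffs ` U1 \<subseteq> polys t"
    using image_mono[OF U(1), of poly_of_coeffs] by (simp only: image_poly_of_coeffs)
  have sp: "sp1 (regular_module p t) = module_vec TYPE('k) t" "sp2 (regular_module p t) = module_vec TYPE('k) t"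
    by (simp_all add: regular_module_def)
  \<comment> \<open>Dimensions translate into cardinalities only for subspaces; if one of the sets
    is no subspace, both sides fail.\<close>
  show ?thesis
  proof (cases "poly_vs.subspace (poly_of_coeffs ` U1) \<and> poly_vs.subspace (poly_of_coeffs ` U2)")
    case True
    then have s: "VectorSpace.subspace class_ring U1 (module_vec TYPE('k) t)"
      "VectorSpace.subspace class_ring U2 (module_vec TYPE('k) t)"
      by (simp_all add: subspace_module_vec_iff U)
    show ?thesis
      unfolding kr_Gr_def is_kr_submodule_def pairs_def mem_Collect_eq prod.case of_nat_eq_iff
        sp kr_condition_iff[OF U conjunct1[OF True] conjunct2[OF True], where p = p, unfolded sp]
        subspace_dim_eq_iff[OF s(1)] subspace_dim_eq_iff[OF s(2)] card[OF U(1)] card[OF U(2)]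
      using True s sub by argo
  next
    case False
    have "(U1, U2) \<notin> kr_Gr class_ring (regular_module p t) (int a) (int b)"
      unfolding kr_Gr_def is_kr_submodule_def mem_Collect_eq prod.case sp
        subspace_module_vec_iff[OF U(1)] subspace_module_vec_iff[OF U(2)]
      using False by (rule contrapos_nn) (elim conjE, intro conjI, assumption+)
    moreover have "(poly_of_coeffs ` U1, poly_of_coeffs ` U2) \<notin> pairs t a b"
      unfolding pairs_def mem_Collect_eq prod.case
      using False by (rule contrapos_nn) (elim conjE, intro conjI, assumption+)
    ultimately show ?thesis by (simp only: simp_thms)
  qed
qed

lemma kr_Gr_carrier:
  assumes "(U1, U2) \<in> kr_Gr class_ring (regular_module p t) a b"
  shows "U1 \<subseteq> carrier_vec t" "U2 \<subseteq> carrier_vec t"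
  using assms
  by (auto simp: kr_Gr_def is_kr_submodule_def regular_module_def VectorSpace.subspace_def
      submodule_def module_vec_simps)

lemma card_kr_Gr:
  fixes p :: "'k::{field,finite} point"
  shows "card (kr_Gr class_ring (regular_module p t) (int a) (int b)) =
    card (pairs t a b :: ('k poly set \<times> _) set)"
proof (rule bij_betw_same_card, rule bij_betw_imageI)
  let ?f = "\<lambda>(U1, U2). (poly_of_coeffs ` U1, poly_of_coeffs ` U2) :: 'k poly set \<times> 'k poly set"
  let ?X = "kr_Gr class_ring (regular_module p t) (int a) (int b)"
  show "inj_on ?f ?X"
  proof (rule inj_onI, clarify)
    fix U1 U2 W1 W2 assume "(U1, U2) \<in> ?X" "(W1, W2) \<in> ?X"
      and eq: "poly_of_coeffs ` U1 = poly_of_coeffs ` W1" "poly_of_coeffs ` U2 = poly_of_coeffs ` W2"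
    note c = kr_Gr_carrier[OF this(1)] kr_Gr_carrier[OF this(2)]
    show "U1 = W1 \<and> U2 = W2"
      using eq inj_on_image_eq_iff[OF inj_on_poly_of_coeffs c(1,3)]
        inj_on_image_eq_iff[OF inj_on_poly_of_coeffs c(2,4)] by simp
  qed
  show "?f ` ?X = pairs t a b"
  proof (intro equalityI subsetI)
    fix x assume "x \<in> ?f ` ?X"
    then obtain U1 U2 where x: "(U1, U2) \<in> ?X" "x = (poly_of_coeffs ` U1, poly_of_coeffs ` U2)" by auto
    show "x \<in> pairs t a b"
      using x(1) unfolding x(2) by (simp only: mem_kr_Gr_iff[OF kr_Gr_carrier[OF x(1)]])
  next
    \<comment> \<open>For surjectivity, both components lie in \<open>polys t\<close>, the image of
      \<open>carrier_vec t\<close>, and so are images of sets of vectors.\<close>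
    fix x assume x: "x \<in> (pairs t a b :: ('k poly set \<times> _) set)"
    then obtain P1 P2 where P: "x = (P1, P2)" "P1 \<subseteq> poly_of_coeffs ` carrier_vec t"
      "P2 \<subseteq> poly_of_coeffs ` carrier_vec t"
      unfolding image_poly_of_coeffs by (auto simp: pairs_def)
    obtain U1 where U1: "U1 \<subseteq> carrier_vec t" "P1 = poly_of_coeffs ` U1"
      using P(2) by (rule subset_imageE)
    obtain U2 where U2: "U2 \<subseteq> carrier_vec t" "P2 = poly_of_coeffs ` U2"
      using P(3) by (rule subset_imageE)
    have "(U1, U2) \<in> ?X"
      using x unfolding P(1) U1(2) U2(2) by (simp only: mem_kr_Gr_iff[OF U1(1) U2(1)])
    then show "x \<in> ?f ` ?X" unfolding P(1) U1(2) U2(2) by (intro image_eqI[of _ _ "(U1, U2)"]) simp_all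
  qed
qed

theorem theorem4p6:
  fixes p :: "'k::{field, finite} point" and q t :: nat and a b :: int
  assumes "q = CARD('k)" and "t \<ge> 1"
  shows "rat_of_nat (card (kr_Gr (class_ring :: 'k ring) (regular_module p t) a b)) =
    (if a < 0 \<or> b < 0 then 0
     else gauss (rat_of_nat q) (int t - a) (int t - b) * gauss (rat_of_nat q) (a - b) a)"
proof (cases "a < 0 \<or> b < 0")
  case True
  \<comment> \<open>Dimensions are naturals embedded in the integers, so a negative value is never
    attained.\<close>
  then have "kr_Gr (class_ring :: 'k ring) (regular_module p t) a b = {}"
    by (auto simp: kr_Gr_def)
  then show ?thesis using True by simp
next
  case False
  then have ab: "a = int (nat a)" "b = int (nat b)" by simp_all
  have q: "rat_of_nat q = of_nat CARD('k)" using assms(1) by simp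
  have "rat_of_nat (card (kr_Gr (class_ring :: 'k ring) (regular_module p t) a b)) =
      gauss (rat_of_nat q) (int t - a) (int t - b) * gauss (rat_of_nat q) (a - b) a"
    using card_kr_Gr[of p t "nat a" "nat b"] card_pairs_closed(1)[OF q, of t "nat a" "nat b"]
    by (simp only: ab[symmetric])
  then show ?thesis using False by simp
qed

end
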